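(* Let $\mathcal{A}$ be a finite or countably infinite alphabet, let $X=\mathcal{A}^{\mathbb{Z}_-}$, and let $K\subset X$ be a subshift. The following are equivalent: (i) $K$ has a strictly positive $g$-function. (ii) $K\cap\overline{K_e}=\emptyset$. (iii) $K_e$ is closed.
   Context: $\mathbb{Z}_-=\{0,-1,-2,\dots\}$. The alphabet $\mathcal{A}$ (nonempty, finite or countably infinite) carries the discrete topology, and $X=\mathcal{A}^{\mathbb{Z}_-}$, the set of all sequences $x=(\dots,x_{-1},x_0)$ with entries in $\mathcal{A}$, carries the product topology. The shift $\Theta:X\to X$ is $\Theta(x)_j=x_{j-1}$, $j\in\mathbb{Z}_-$ (it deletes the last symbol $x_0$). A subshift of $X$ is a closed nonempty subset $K\subset X$ with $K=\Theta(K)$. $\mathcal{G}$ is the set of all continuous functions $g:X\to[0,1]$ such that $\sum_{x'\in\Theta^{-1}(x)}g(x')=1$ for every $x\in X$. $K^c$ is the complement of $K$ in $X$, overline denotes closure in $X$, and $K_e=\{x\in K^c:\Theta(x)\in K\}$. $K$ is invariant for $g\in\mathcal{G}$ if $g(x)=0$ for all $x\in K_e$. $K$ has a strictly positive $g$-function if $K$ is invariant for some $g\in\mathcal{G}$ such that $g(x)>0$ for all $x\in K$. *)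

theory Defs
  imports "HOL-Analysis.Analysis"
begin

text \<open>
  The alphabet is a type \<open>'a :: {countable, discrete_topology}\<close>. A left-infinite sequence
  \<open>(\<dots>, x\<^sub>-\<^sub>1, x\<^sub>0)\<close> is encoded as a function \<open>x :: nat \<Rightarrow> 'a\<close>, where \<open>x n\<close> is the entry at
  position \<open>-n\<close>. The type \<open>nat \<Rightarrow> 'a\<close> carries the product topology.
\<close>

type_synonym 'a seqs = "nat \<Rightarrow> 'a"

text \<open>Position \<open>j - 1\<close> for \<open>j = -n\<close> is position \<open>-(n + 1)\<close>, so the last symbol \<open>x 0\<close> is deleted.\<close>

definition shift :: "'a seqs \<Rightarrow> 'a seqs" where
  "shift x = (\<lambda>n. x (Suc n))"

definition subshift :: "('a :: discrete_topology) seqs set \<Rightarrow> bool" where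
  "subshift K \<longleftrightarrow> closed K \<and> K \<noteq> {} \<and> K = shift ` K"

text \<open>
  The fibres of the shift are infinite if the alphabet is, so the normalization is an
  unconditional sum.
\<close>

definition g_functions :: "(('a :: discrete_topology) seqs \<Rightarrow> real) set" where
  "g_functions = {g. continuous_on UNIV g \<and> (\<forall>x. g x \<in> {0..1}) \<and>
     (\<forall>x. (g has_sum 1) (shift -` {x}))}"

definition ext_set :: "'a seqs set \<Rightarrow> 'a seqs set" where
  "ext_set K = {x. x \<in> - K \<and> shift x \<in> K}"

definition invariant_for :: "('a seqs \<Rightarrow> real) \<Rightarrow> 'a seqs set \<Rightarrow> bool" where
  "invariant_for g K \<longleftrightarrow> (\<forall>x \<in> ext_set K. g x = 0)"

definition has_strictly_positive_g_function :: "('a :: discrete_topology) seqs set \<Rightarrow> bool" where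
  "has_strictly_positive_g_function K \<longleftrightarrow>
     (\<exists>g \<in> g_functions. invariant_for g K \<and> (\<forall>x \<in> K. g x > 0))"

end

theory Submission
  imports Defs
begin

text \<open>
  Write \<open>E = ext_set K\<close> for the set of one-symbol extensions that leave \<open>K\<close>. Since \<open>K\<close> is closed
  and the shift is continuous, limits of points of \<open>E\<close> still have their shift in \<open>K\<close>, so such
  a limit can leave \<open>E\<close> only by entering \<open>K\<close>: hence \<open>closure E\<close> misses \<open>K\<close> if and only if \<open>E\<close> is
  closed (lemma \<open>disjoint_closure_ext_set_iff\<close>). A continuous \<open>g\<close> that vanishes on \<open>E\<close> vanishes on
  \<open>closure E\<close>, so strict positivity on \<open>K\<close> forces disjointness.

  The substance is the construction of \<open>g\<close> when \<open>E\<close> is closed. A continuous function need not be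
  normalized from the start: a nonnegative \<open>h\<close> can be divided by its sum over each fibre, without
  changing its zeros, as long as no fibre sum vanishes and the fibre sum depends continuously on
  the base point (lemma \<open>fibre_normalization\<close>). Let \<open>d C\<close> be a continuous function that is
  zero exactly on the closed set \<open>C\<close>, and put
    \<open>h x = (1/2) ^ to_nat (x 0) * (d E x + d K (shift x))\<close>.
  On \<open>E\<close> both summands vanish. On \<open>K\<close> the first one is positive, because \<open>E\<close> is closed and misses
  \<open>K\<close>. In a fibre over a point outside \<open>K\<close> the second summand is positive, and a
  fibre over a point of \<open>K = shift ` K\<close> contains a point of \<open>K\<close>; so no fibre sum vanishes. The
  geometric weights make the fibre sums converge uniformly even for an infinite alphabet.
\<close>

section \<open>Closed sets of sequences as zero sets\<close>

lemma continuous_on_shift: "continuous_on UNIV (shift :: ('a :: topological_space) seqs \<Rightarrow> 'a seqs)"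
  unfolding shift_def by (intro continuous_intros) simp

lemma open_cylinder: "open {y :: ('a :: discrete_topology) seqs. \<forall>i<n. y i = x i}"
proof -
  have "open ((\<lambda>y :: 'a seqs. y i) -` {x i})" for i
    by (intro open_vimage open_discrete) simp
  hence "open (\<Inter>i\<in>{..<n}. (\<lambda>y :: 'a seqs. y i) -` {x i})"
    by (intro open_INT) auto
  also have "(\<Inter>i\<in>{..<n}. (\<lambda>y :: 'a seqs. y i) -` {x i}) = {y. \<forall>i<n. y i = x i}"
    by auto
  finally show ?thesis .
qed

lemma continuous_on_finitely_determined:
  fixes f :: "('a :: discrete_topology) seqs \<Rightarrow> 'b :: topological_space"
  assumes "\<And>x y. (\<And>i. i < n \<Longrightarrow> x i = y i) \<Longrightarrow> f x = f y"
  shows "continuous_on UNIV f"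
proof -
  have "(f \<longlongrightarrow> f x) (at x)" for x
  proof (rule tendsto_eventually, rule eventually_at_topological[THEN iffD2], intro exI conjI ballI impI)
    show "open {y. \<forall>i<n. y i = x i}" by (rule open_cylinder)
    show "f y = f x" if "y \<in> {y. \<forall>i<n. y i = x i}" for y
      using that by (intro assms) auto
  qed simp
  thus ?thesis by (simp add: continuous_on_def)
qed

text \<open>
  The cylinders form a neighbourhood basis: if every cylinder around \<open>x\<close> met \<open>C\<close>, then
  points of \<open>C\<close> that agree with \<open>x\<close> in more and more of the last symbols would converge to \<open>x\<close>
  coordinatewise, and \<open>x\<close> would belong to the closed set \<open>C\<close>.
\<close>

lemma closed_avoids_cylinder:
  fixes C :: "('a :: discrete_topology) seqs set"
  assumes "closed C" "x \<notin> C"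
  obtains n where "\<And>y. y \<in> C \<Longrightarrow> \<exists>i<n. y i \<noteq> x i"
proof (rule ccontr)
  assume "\<not> thesis"
  hence "\<forall>n. \<exists>y\<in>C. \<forall>i<n. y i = x i"
    using that by blast
  then obtain Y where Y: "\<And>n. Y n \<in> C" "\<And>n i. i < n \<Longrightarrow> Y n i = x i"
    by metis
  have "((\<lambda>n. Y n i) \<longlongrightarrow> x i) sequentially" for i
    by (rule tendsto_eventually, rule eventually_mono[OF eventually_gt_at_top[of i]]) (rule Y(2))
  hence "limitin (product_topology (\<lambda>i. euclidean) UNIV) Y x sequentially"
    by (simp add: limitin_componentwise)
  hence "Y \<longlonglongrightarrow> x"
    by (simp add: euclidean_product_topology)
  hence "x \<in> C"
    using assms(1) Y(1) by (intro Lim_in_closed_set[of C Y sequentially]) auto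
  with assms(2) show False by simp
qed

lemma continuous_on_infsum:
  fixes f :: "'i \<Rightarrow> 'b :: topological_space \<Rightarrow> 'c :: banach"
  assumes "\<And>i. continuous_on S (f i)" "\<And>i x. x \<in> S \<Longrightarrow> norm (f i x) \<le> M i" "M summable_on A"
  shows "continuous_on S (\<lambda>x. \<Sum>\<^sub>\<infinity>i\<in>A. f i x)"
  using Weierstrass_m_test_general[of A S f M] assms
  by (intro uniform_limit_theorem[of _ "\<lambda>X x. \<Sum>i\<in>X. f i x" "finite_subsets_at_top A"])
     (auto intro!: always_eventually continuous_on_sum)

text \<open>
  A substitute for the distance to \<open>C\<close> that needs no metric on the alphabet. Each summand depends
  on finitely many symbols of \<open>x\<close>, hence is locally constant, and the geometric factors carry
  continuity over to the sum.
\<close>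

definition cylinder_dist :: "'a seqs set \<Rightarrow> 'a seqs \<Rightarrow> real" where
  "cylinder_dist C x = (\<Sum>\<^sub>\<infinity>n. (1/2) ^ n * of_bool (\<forall>y\<in>C. \<exists>i<n. y i \<noteq> x i))"

lemma summable_on_half_powers: "(\<lambda>n. (1/2 :: real) ^ n) summable_on A"
  by (rule summable_on_subset_banach[OF norm_summable_imp_summable_on, of _ A]) auto

lemma summable_cylinder_dist:
  "(\<lambda>n. (1/2 :: real) ^ n * of_bool (P n)) summable_on UNIV"
  by (rule summable_on_comparison_test[OF summable_on_half_powers]) auto

lemma cylinder_dist_nonneg: "cylinder_dist C x \<ge> 0"
  unfolding cylinder_dist_def by (intro infsum_nonneg) auto

lemma cylinder_dist_le_2: "cylinder_dist C x \<le> 2"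
proof -
  have "((\<lambda>n. (1/2 :: real) ^ n) has_sum 2) UNIV"
    using geometric_sums[of "1/2 :: real"] by (intro sums_nonneg_imp_has_sum) auto
  thus ?thesis unfolding cylinder_dist_def
    by (intro has_sum_mono[OF has_sum_infsum[OF summable_cylinder_dist]]) auto
qed

lemma continuous_on_cylinder_dist:
  "continuous_on UNIV (cylinder_dist (C :: ('a :: discrete_topology) seqs set))"
  unfolding cylinder_dist_def
proof (rule continuous_on_infsum[OF _ _ summable_on_half_powers])
  show "continuous_on UNIV (\<lambda>x. (1/2 :: real) ^ n * of_bool (\<forall>y\<in>C. \<exists>i<n. y i \<noteq> x i))" for n
    by (rule continuous_on_finitely_determined[of n]) (auto, metis+)
qed auto

lemma cylinder_dist_mem: "x \<in> C \<Longrightarrow> cylinder_dist C x = 0"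
  unfolding cylinder_dist_def by (intro infsum_0) auto

lemma cylinder_dist_pos:
  fixes C :: "('a :: discrete_topology) seqs set"
  assumes "closed C" "x \<notin> C"
  shows "cylinder_dist C x > 0"
proof -
  obtain n where n: "\<And>y. y \<in> C \<Longrightarrow> \<exists>i<n. y i \<noteq> x i"
    using closed_avoids_cylinder[OF assms] by blast
  have "0 < (\<Sum>k\<in>{n}. (1/2 :: real) ^ k * of_bool (\<forall>y\<in>C. \<exists>i<k. y i \<noteq> x i))"
    using n by simp
  also have "\<dots> \<le> cylinder_dist C x"
    unfolding cylinder_dist_def by (intro finite_sum_le_infsum summable_cylinder_dist) auto
  finally show ?thesis .
qed

section \<open>Normalizing over the fibres of the shift\<close>

text \<open>The sequence \<open>case_nat a x\<close> is \<open>x\<close> with the new last symbol \<open>a\<close>.\<close>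

lemma shift_case_nat [simp]: "shift (case_nat a x) = x"
  by (simp add: shift_def)

lemma case_nat_shift [simp]: "case_nat (x 0) (shift x) = x"
  by (auto simp: shift_def split: nat.split)

lemma continuous_on_case_nat:
  "continuous_on UNIV (case_nat a :: ('a :: topological_space) seqs \<Rightarrow> 'a seqs)"
proof (rule continuous_on_coordinatewise_then_product)
  show "continuous_on UNIV (\<lambda>x :: 'a seqs. case_nat a x i)" for i
    by (cases i) auto
qed

lemma has_sum_fibre_iff: "(g has_sum s) (shift -` {x}) \<longleftrightarrow> ((\<lambda>a. g (case_nat a x)) has_sum s) UNIV"
proof (rule has_sum_reindex_bij_witness[of _ "\<lambda>a. case_nat a x" "\<lambda>y. y 0"])
  show "case_nat (y 0) x = y" if "y \<in> shift -` {x}" for y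
    using that case_nat_shift[of y] by simp
  thus "g (case_nat (y 0) x) = g y" if "y \<in> shift -` {x}" for y
    using that by simp
qed simp_all

text \<open>
  The bound by a summable function of the last symbol alone makes the fibre sums converge uniformly
  in the base point, so that they are continuous.
\<close>

lemma fibre_normalization:
  fixes h :: "('a :: discrete_topology) seqs \<Rightarrow> real"
  assumes cont: "continuous_on UNIV h" and nonneg: "\<And>x. h x \<ge> 0"
    and bound: "\<And>x. h x \<le> M (x 0)" and summable: "M summable_on UNIV"
    and pos: "\<And>x. \<exists>a. h (case_nat a x) > 0"
  obtains g where "g \<in> g_functions" "\<And>x. g x = 0 \<longleftrightarrow> h x = 0"
proof
  define N where "N x = (\<Sum>\<^sub>\<infinity>a. h (case_nat a x))" for x
  define g where "g x = h x / N (shift x)" for x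
  have h_summable: "(\<lambda>a. h (case_nat a x)) summable_on UNIV" for x
    using bound[of "case_nat a x" for a] nonneg
    by (intro summable_on_comparison_test[OF summable]) auto
  have h_le: "h (case_nat a x) \<le> N x" for a x
    using finite_sum_le_infsum[OF h_summable, of "{a}"] nonneg by (simp add: N_def)
  have N_pos: "N x > 0" for x
    using pos[of x] h_le[of _ x] by (meson less_le_trans)
  have "continuous_on UNIV (\<lambda>x. h (case_nat a x))" for a
    using continuous_on_compose2[OF cont continuous_on_case_nat] by simp
  hence "continuous_on UNIV N"
    unfolding N_def using bound[of "case_nat a x" for a x] nonneg
    by (intro continuous_on_infsum[OF _ _ summable]) auto
  hence "continuous_on UNIV (\<lambda>x. N (shift x))"
    using continuous_on_compose2[OF _ continuous_on_shift] by blast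
  hence g_cont: "continuous_on UNIV g"
    unfolding g_def using N_pos by (intro continuous_on_divide cont) (auto simp: less_imp_neq[symmetric])
  have g_range: "g x \<in> {0..1}" for x
    using h_le[of "x 0" "shift x"] N_pos[of "shift x"] nonneg[of x]
    by (simp add: g_def)
  have "((\<lambda>a. h (case_nat a x) * inverse (N x)) has_sum N x * inverse (N x)) UNIV" for x
    unfolding N_def by (intro has_sum_cmult_left has_sum_infsum h_summable)
  moreover have "N x * inverse (N x) = 1" for x
    using N_pos[of x] by simp
  ultimately have "(g has_sum 1) (shift -` {x})" for x
    by (simp add: has_sum_fibre_iff g_def divide_inverse)
  with g_cont g_range show "g \<in> g_functions"
    by (simp add: g_functions_def)
  show "g x = 0 \<longleftrightarrow> h x = 0" for x
    using N_pos[of "shift x"] by (simp add: g_def)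
qed

section \<open>Positive g-functions and the extension set\<close>

lemma disjoint_closure_ext_set_iff:
  fixes K :: "('a :: topological_space) seqs set"
  assumes "closed K"
  shows "K \<inter> closure (ext_set K) = {} \<longleftrightarrow> closed (ext_set K)"
proof
  have "closed (shift -` K)"
    using assms continuous_on_shift by (rule closed_vimage)
  hence "closure (ext_set K) \<subseteq> shift -` K"
    by (intro closure_minimal) (auto simp: ext_set_def)
  moreover assume "K \<inter> closure (ext_set K) = {}"
  ultimately have "closure (ext_set K) \<subseteq> ext_set K"
    by (auto simp: ext_set_def)
  thus "closed (ext_set K)"
    using closure_subset_eq by blast
next
  assume "closed (ext_set K)"
  thus "K \<inter> closure (ext_set K) = {}"
    by (auto simp: ext_set_def)
qed

lemma positive_g_function_imp_disjoint:
  assumes "has_strictly_positive_g_function K"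
  shows "K \<inter> closure (ext_set K) = {}"
proof -
  obtain g :: "_ \<Rightarrow> real" where g: "continuous_on UNIV g" "\<forall>x\<in>ext_set K. g x = 0" "\<forall>x\<in>K. g x > 0"
    using assms unfolding has_strictly_positive_g_function_def g_functions_def invariant_for_def by blast
  have "g x = 0" if "x \<in> closure (ext_set K)" for x
    using continuous_constant_on_closure[OF continuous_on_subset[OF g(1)] _ that] g(2) by auto
  with g(3) show ?thesis by force
qed

lemma closed_ext_set_imp_positive_g_function:
  fixes K :: "('a :: {countable, discrete_topology}) seqs set"
  assumes K: "closed K" "K \<subseteq> shift ` K" and E: "closed (ext_set K)"
  shows "has_strictly_positive_g_function K"
proof -
  define w :: "'a \<Rightarrow> real" where "w a = (1/2) ^ to_nat a" for a
  define h where "h x = w (x 0) * (cylinder_dist (ext_set K) x + cylinder_dist K (shift x))" for x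
  have w_pos: "w a > 0" for a by (simp add: w_def)
  have "w summable_on UNIV"
    using summable_on_reindex[of "to_nat :: 'a \<Rightarrow> nat" UNIV "\<lambda>n. (1/2 :: real) ^ n"]
      summable_on_half_powers[of "range (to_nat :: 'a \<Rightarrow> nat)"]
    by (simp add: w_def[abs_def] o_def)
  \<comment> \<open>The factor 4 bounds the sum of two values of \<open>cylinder_dist\<close>.\<close>
  hence summable: "(\<lambda>a. w a * 4) summable_on UNIV"
    by (rule summable_on_cmult_left)
  have bound: "h x \<le> w (x 0) * 4" for x
    unfolding h_def using cylinder_dist_le_2[of "ext_set K" x] cylinder_dist_le_2[of K "shift x"] w_pos[of "x 0"]
    by (intro mult_left_mono) auto
  have nonneg: "h x \<ge> 0" for x
    unfolding h_def using w_pos[of "x 0"] by (intro mult_nonneg_nonneg add_nonneg_nonneg cylinder_dist_nonneg) auto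
  have "continuous_on UNIV (\<lambda>x :: 'a seqs. w (x 0))"
    by (rule continuous_on_finitely_determined[of 1]) simp
  hence cont: "continuous_on UNIV h"
    unfolding h_def
    by (intro continuous_intros continuous_on_cylinder_dist
        continuous_on_compose2[OF continuous_on_cylinder_dist continuous_on_shift]) auto
  have h_pos: "h x > 0" if "x \<notin> ext_set K \<or> shift x \<notin> K" for x
    unfolding h_def using that cylinder_dist_pos[OF E, of x] cylinder_dist_pos[OF K(1), of "shift x"]
      cylinder_dist_nonneg[of "ext_set K" x] cylinder_dist_nonneg[of K "shift x"] w_pos[of "x 0"]
    by (intro mult_pos_pos) auto
  have fibre_pos: "\<exists>a. h (case_nat a x) > 0" for x
  proof (cases "x \<in> K")
    case True
    then obtain y where y: "y \<in> K" "x = shift y" using K(2) by auto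
    hence "h (case_nat (y 0) x) > 0"
      using h_pos[of y] by (simp add: ext_set_def)
    thus ?thesis ..
  next
    case False
    \<comment> \<open>Over a point outside \<open>K\<close> any symbol will do, so an unspecified one is taken.\<close>
    thus ?thesis using h_pos[of "case_nat undefined x"] by auto
  qed
  obtain g where g: "g \<in> g_functions" "\<And>x. g x = 0 \<longleftrightarrow> h x = 0"
    using fibre_normalization[OF cont nonneg bound summable fibre_pos] by blast
  have "g x = 0" if "x \<in> ext_set K" for x
    using that by (simp add: g(2) h_def cylinder_dist_mem ext_set_def)
  moreover have "g x > 0" if "x \<in> K" for x
  proof -
    have "h x > 0" using that by (intro h_pos) (simp add: ext_set_def)
    hence "g x \<noteq> 0" using g(2) by force
    moreover have "g x \<ge> 0" using g(1) by (simp add: g_functions_def)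
    ultimately show ?thesis by simp
  qed
  ultimately show ?thesis
    using g(1) by (auto simp: has_strictly_positive_g_function_def invariant_for_def)
qed

theorem proposition3:
  fixes K :: "('a :: {countable, discrete_topology}) seqs set"
  assumes "subshift K"
  shows "(has_strictly_positive_g_function K \<longleftrightarrow> K \<inter> closure (ext_set K) = {}) \<and>
         (K \<inter> closure (ext_set K) = {} \<longleftrightarrow> closed (ext_set K))"
proof -
  have "closed K" "K \<subseteq> shift ` K"
    using assms by (auto simp: subshift_def)
  thus ?thesis
    using disjoint_closure_ext_set_iff[of K] positive_g_function_imp_disjoint[of K]
      closed_ext_set_imp_positive_g_function[of K] by blast
qed

end
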